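(* Let $r,m,n\ge1$ be integers, and let $\alpha_j,\beta,\gamma_i\in\mathbb{R}$ and $a_j,b,c_i\in\mathbb{R}^n$ for $j=1,\dots,r$ and $i=1,\dots,m$. Consider the problem $$(\mathcal P^l)\quad \inf_{x\in\mathbb{R}^n}\Big\{\max_{1\le j\le r}\frac{a_j^Tx+\alpha_j}{b^Tx+\beta} : c_i^Tx+\gamma_i\le 0,\ i=1,\dots,m\Big\}$$ and the linear program $(\mathcal D^l)$: maximize $\mu$ subject to $$\sum_{j=1}^r\delta_ja_j+\sum_{i=1}^m\lambda_ic_i-\mu b=0,\qquad \sum_{j=1}^r\delta_j\alpha_j+\sum_{i=1}^m\lambda_i\gamma_i-\mu\beta\ge0,\qquad \delta\in\Delta,\ \lambda\in\mathbb{R}^m_+,\ \mu\in\mathbb{R}.$$ Assume that the feasible set of $(\mathcal P^l)$ is nonempty and that $b^Tx+\beta>0$ for every feasible point $x$ of $(\mathcal P^l)$. Then $\inf(\mathcal P^l)=\max(\mathcal D^l)$; that is, the optimal values of $(\mathcal P^l)$ and $(\mathcal D^l)$ are equal and, when this common value is finite, it is attained in $(\mathcal D^l)$.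
   Context: $\mathbb{R}^k_+$ denotes the set of vectors in $\mathbb{R}^k$ with nonnegative coordinates, and $\Delta:=\{\delta\in\mathbb{R}^r_+ : \sum_{j=1}^r\delta_j=1\}$. Optimal values are taken in $[-\infty,+\infty]$, with $\sup\emptyset=-\infty$. *)

theory Defs
  imports "HOL-Analysis.Analysis"
begin

text \<open>The dimensions r, m, n are the cardinalities of the finite index types
  \<open>'r\<close>, \<open>'m\<close>, \<open>'n\<close>; each is at least 1 because HOL types are nonempty.
  The multiplier written \<open>\<lambda>\<close> in the mathematics is called \<open>\<eta>\<close>, since the former is the
  binder of HOL.\<close>

definition nonneg_orthant :: "(real ^ 'k) set" where
  "nonneg_orthant = {x. \<forall>i. 0 \<le> x $ i}"

definition unit_simplex :: "(real ^ 'r) set" where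
  "unit_simplex = {\<delta> \<in> nonneg_orthant. (\<Sum>j\<in>UNIV. \<delta> $ j) = 1}"

definition primal_feasible :: "(real ^ 'n) ^ 'm \<Rightarrow> real ^ 'm \<Rightarrow> (real ^ 'n) set" where
  "primal_feasible c \<gamma> = {x. \<forall>i. c $ i \<bullet> x + \<gamma> $ i \<le> 0}"

definition primal_objective ::
  "(real ^ 'n) ^ 'r \<Rightarrow> real ^ 'r \<Rightarrow> real ^ 'n \<Rightarrow> real \<Rightarrow> real ^ 'n \<Rightarrow> real" where
  "primal_objective a \<alpha> b \<beta> x = (MAX j\<in>UNIV. (a $ j \<bullet> x + \<alpha> $ j) / (b \<bullet> x + \<beta>))"

definition primal_value ::
  "(real ^ 'n) ^ 'r \<Rightarrow> real ^ 'r \<Rightarrow> real ^ 'n \<Rightarrow> real \<Rightarrow> (real ^ 'n) ^ 'm \<Rightarrow> real ^ 'm \<Rightarrow> ereal" where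
  "primal_value a \<alpha> b \<beta> c \<gamma> =
     (INF x\<in>primal_feasible c \<gamma>. ereal (primal_objective a \<alpha> b \<beta> x))"

definition dual_feasible ::
  "(real ^ 'n) ^ 'r \<Rightarrow> real ^ 'r \<Rightarrow> real ^ 'n \<Rightarrow> real \<Rightarrow> (real ^ 'n) ^ 'm \<Rightarrow> real ^ 'm
    \<Rightarrow> ((real ^ 'r) \<times> (real ^ 'm) \<times> real) set" where
  "dual_feasible a \<alpha> b \<beta> c \<gamma> =
     {(\<delta>, \<eta>, \<mu>).
        (\<Sum>j\<in>UNIV. \<delta> $ j *\<^sub>R a $ j) + (\<Sum>i\<in>UNIV. \<eta> $ i *\<^sub>R c $ i) - \<mu> *\<^sub>R b = 0 \<and>
        (\<Sum>j\<in>UNIV. \<delta> $ j * \<alpha> $ j) + (\<Sum>i\<in>UNIV. \<eta> $ i * \<gamma> $ i) - \<mu> * \<beta> \<ge> 0 \<and>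
        \<delta> \<in> unit_simplex \<and> \<eta> \<in> nonneg_orthant}"

definition dual_value ::
  "(real ^ 'n) ^ 'r \<Rightarrow> real ^ 'r \<Rightarrow> real ^ 'n \<Rightarrow> real \<Rightarrow> (real ^ 'n) ^ 'm \<Rightarrow> real ^ 'm \<Rightarrow> ereal" where
  "dual_value a \<alpha> b \<beta> c \<gamma> = (SUP (\<delta>, \<eta>, \<mu>)\<in>dual_feasible a \<alpha> b \<beta> c \<gamma>. ereal \<mu>)"

end

theory Submission
  imports Defs
begin

text \<open>If \<open>v\<close> is the finite primal value, then positivity of the denominator turns the
  inequality \<open>v \<le> primal_objective\<close> into the statement that the affine functions
  \<open>(a\<^sub>j - v b) \<bullet> x + (\<alpha>\<^sub>j - v \<beta>)\<close> are never simultaneously negative on the feasible polyhedron.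
  Farkas' lemma, applied after homogenisation, then supplies multipliers \<open>\<delta>\<close> and \<open>\<eta>\<close> such
  that \<open>(\<delta>, \<eta>, v)\<close> is dual feasible; weak duality makes it optimal.\<close>

text \<open>A finitely generated convex cone is closed, so a point outside it can be strictly
  separated from it. By scaling, the separating functional is nonnegative on every generator, and
  \<open>sep\<close> then contradicts its negative value at \<open>y\<close>.\<close>

lemma farkas:
  fixes f :: "'k \<Rightarrow> 'v::euclidean_space"
  assumes "finite I" and sep: "\<And>z. (\<And>i. i \<in> I \<Longrightarrow> 0 \<le> z \<bullet> f i) \<Longrightarrow> 0 \<le> z \<bullet> y"
  obtains w where "\<And>i. i \<in> I \<Longrightarrow> 0 \<le> w i" and "(\<Sum>i\<in>I. w i *\<^sub>R f i) = y"
proof -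
  \<comment> \<open>Closedness is known for the hull, explicit weights for \<open>K\<close>; only
    the inclusion of the hull in \<open>K\<close> is needed to pass from one to the other.\<close>
  define K where "K = {x. \<exists>w. (\<forall>i\<in>I. 0 \<le> w i) \<and> (\<Sum>i\<in>I. w i *\<^sub>R f i) = x}"
  let ?C = "convex_cone hull (f ` I)"
  have "convex_cone K"
    unfolding convex_cone_iff
  proof (intro conjI ballI allI impI)
    show "0 \<in> K" unfolding K_def by (auto intro!: exI[of _ "\<lambda>_. 0"])
  next
    fix x x' assume "x \<in> K" "x' \<in> K"
    then obtain w w' where "\<forall>i\<in>I. 0 \<le> w i" "\<forall>i\<in>I. 0 \<le> w' i"
      "(\<Sum>i\<in>I. w i *\<^sub>R f i) = x" "(\<Sum>i\<in>I. w' i *\<^sub>R f i) = x'"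
      unfolding K_def by auto
    then show "x + x' \<in> K" unfolding K_def
      by (auto intro!: exI[of _ "\<lambda>i. w i + w' i"] simp: scaleR_add_left sum.distrib)
  next
    fix x and t :: real assume "x \<in> K" "0 \<le> t"
    then obtain w where "\<forall>i\<in>I. 0 \<le> w i" "(\<Sum>i\<in>I. w i *\<^sub>R f i) = x"
      unfolding K_def by auto
    with \<open>0 \<le> t\<close> show "t *\<^sub>R x \<in> K" unfolding K_def
      by (auto intro!: exI[of _ "\<lambda>i. t * w i"] simp: scaleR_sum_right)
  qed
  moreover have "f ` I \<subseteq> K"
  proof clarify
    fix i assume "i \<in> I"
    with \<open>finite I\<close> show "f i \<in> K" unfolding K_def
      by (auto intro!: exI[of _ "\<lambda>k. if k = i then 1 else 0"]
          simp: if_distrib[of "\<lambda>t. t *\<^sub>R _"] cong: if_cong)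
  qed
  ultimately have "?C \<subseteq> K" by (simp add: hull_minimal)
  moreover have "y \<in> ?C"
  proof (rule ccontr)
    assume "y \<notin> ?C"
    then obtain z t where z: "z \<bullet> y < t" "\<And>x. x \<in> ?C \<Longrightarrow> t < z \<bullet> x"
      using separating_hyperplane_closed_point[of ?C y] \<open>finite I\<close>
      by (auto simp: closed_convex_cone_hull convex_convex_cone_hull)
    have "t < 0" using z(2)[OF convex_cone_hull_contains_0] by simp
    have "0 \<le> z \<bullet> f i" if "i \<in> I" for i
    proof (rule ccontr)
      assume neg: "\<not> 0 \<le> z \<bullet> f i"
      \<comment> \<open>The factor is positive, as both \<open>t\<close> and
        \<open>z \<bullet> f i\<close> are negative. On this multiple \<open>z\<close> takes exactly
        the value \<open>t\<close>, against the strict separation.\<close>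
      have "(t / (z \<bullet> f i)) *\<^sub>R f i \<in> ?C"
        using that neg \<open>t < 0\<close>
        by (intro convex_cone_hull_mul hull_inc) (auto simp: divide_simps)
      from z(2)[OF this] neg show False by simp
    qed
    with sep z(1) \<open>t < 0\<close> show False by force
  qed
  ultimately show thesis using that unfolding K_def by blast
qed

text \<open>Each affine function becomes the vector of its coefficients, and the multipliers sought
  are the weights in a conic representation of \<open>(0, 0, 1)\<close>. A functional obstructing
  this representation would produce a feasible point where all functions given by \<open>a\<close>
  and \<open>\<alpha>\<close> are negative.\<close>

lemma affine_alternative:
  fixes a :: "(real ^ 'n) ^ 'r" and \<alpha> :: "real ^ 'r"
    and c :: "(real ^ 'n) ^ 'm" and \<gamma> :: "real ^ 'm"
  assumes x0: "x0 \<in> primal_feasible c \<gamma>"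
    and nonneg: "\<And>x. x \<in> primal_feasible c \<gamma> \<Longrightarrow> \<exists>j. 0 \<le> a $ j \<bullet> x + \<alpha> $ j"
  obtains \<delta> \<eta> where "\<delta> \<in> unit_simplex" "\<eta> \<in> nonneg_orthant"
    "(\<Sum>j\<in>UNIV. \<delta> $ j *\<^sub>R a $ j) + (\<Sum>i\<in>UNIV. \<eta> $ i *\<^sub>R c $ i) = 0"
    "0 \<le> (\<Sum>j\<in>UNIV. \<delta> $ j * \<alpha> $ j) + (\<Sum>i\<in>UNIV. \<eta> $ i * \<gamma> $ i)"
proof -
  \<comment> \<open>The last coordinate normalises \<open>\<delta>\<close>; the generator indexed by \<open>unit\<close> is a slack for the
    final inequality.\<close>
  define f :: "'r + 'm + unit \<Rightarrow> (real ^ 'n) \<times> real \<times> real" where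
    "f = case_sum (\<lambda>j. (a $ j, \<alpha> $ j, 1)) (case_sum (\<lambda>i. (c $ i, \<gamma> $ i, 0)) (\<lambda>_. (0, -1, 0)))"
  have sep: "0 \<le> z \<bullet> (0, 0, 1)" if z: "\<And>k. k \<in> UNIV \<Longrightarrow> 0 \<le> z \<bullet> f k" for z
  proof (rule ccontr)
    obtain X T u where zeq: "z = (X, T, u)" by (metis surj_pair)
    assume "\<not> 0 \<le> z \<bullet> (0, 0, 1)"
    then have u: "u < 0" by (simp add: zeq)
    have A: "0 \<le> X \<bullet> a $ j + T * \<alpha> $ j + u" for j
      using z[of "Inl j"] by (simp add: zeq f_def)
    have C: "0 \<le> X \<bullet> c $ i + T * \<gamma> $ i" for i
      using z[of "Inr (Inl i)"] by (simp add: zeq f_def)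
    have T: "T \<le> 0"
      using z[of "Inr (Inr ())"] by (simp add: zeq f_def)
    \<comment> \<open>Perturbing towards \<open>x0\<close> covers the case \<open>T = 0\<close>, where \<open>- X\<close> is only a recession
      direction.\<close>
    define M where "M = 1 + (\<Sum>j\<in>UNIV. \<bar>a $ j \<bullet> x0 + \<alpha> $ j\<bar>)"
    have M: "a $ j \<bullet> x0 + \<alpha> $ j < M" for j
      using member_le_sum[of j UNIV "\<lambda>j. \<bar>a $ j \<bullet> x0 + \<alpha> $ j\<bar>"] by (simp add: M_def)
    have "M > 0" unfolding M_def by (smt (verit) sum_nonneg abs_ge_zero)
    \<comment> \<open>With this choice \<open>e * M = - u\<close>, so the contribution of
      \<open>x0\<close> stays below the margin \<open>- u\<close> that \<open>A\<close> provides for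
      every \<open>j\<close>.\<close>
    define e where "e = - u / M"
    have "e > 0" using u \<open>M > 0\<close> by (simp add: e_def divide_neg_pos)
    define s where "s = e - T"
    have "s > 0" using \<open>e > 0\<close> T by (simp add: s_def)
    \<comment> \<open>This dehomogenises \<open>e *\<^sub>R (x0, 1) - (X, T)\<close>, whose last
      coordinate \<open>s\<close> is positive even if \<open>T = 0\<close>.\<close>
    define x where "x = (1 / s) *\<^sub>R (e *\<^sub>R x0 - X)"
    have scale: "s * (p \<bullet> x + q) = e * (p \<bullet> x0 + q) - (X \<bullet> p + T * q)" for p q
    proof -
      have "s * (p \<bullet> x) = p \<bullet> (e *\<^sub>R x0 - X)" using \<open>s > 0\<close> by (simp add: x_def)
      then show ?thesis by (simp add: s_def algebra_simps inner_diff_right inner_commute)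
    qed
    have "x \<in> primal_feasible c \<gamma>"
      unfolding primal_feasible_def
    proof clarify
      fix i
      have "e * (c $ i \<bullet> x0 + \<gamma> $ i) \<le> 0"
        using x0 \<open>e > 0\<close> by (simp add: primal_feasible_def mult_le_0_iff)
      with C[of i] have "s * (c $ i \<bullet> x + \<gamma> $ i) \<le> 0" unfolding scale by linarith
      with \<open>s > 0\<close> show "c $ i \<bullet> x + \<gamma> $ i \<le> 0" by (simp add: mult_le_0_iff)
    qed
    then obtain j where "0 \<le> a $ j \<bullet> x + \<alpha> $ j" using nonneg by blast
    then have "0 \<le> s * (a $ j \<bullet> x + \<alpha> $ j)" using \<open>s > 0\<close> by simp
    moreover have "e * (a $ j \<bullet> x0 + \<alpha> $ j) < e * M" using M \<open>e > 0\<close> by simp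
    moreover have "e * M = - u" using \<open>M > 0\<close> by (simp add: e_def)
    ultimately show False using A[of j] unfolding scale by linarith
  qed
  obtain w where w: "\<And>k. 0 \<le> w k"
    and eq: "(\<Sum>k\<in>UNIV. w k *\<^sub>R f k) = (0, 0, 1)"
    using farkas[of UNIV f, OF finite sep] by (metis UNIV_I)
  let ?\<delta> = "\<chi> j. w (Inl j)" and ?\<eta> = "\<chi> i. w (Inr (Inl i))"
  have split: "(\<Sum>k\<in>UNIV. g k) =
      (\<Sum>j\<in>UNIV. g (Inl j)) + ((\<Sum>i\<in>UNIV. g (Inr (Inl i))) + g (Inr (Inr ())))"
    for g :: "'r + 'm + unit \<Rightarrow> 'z::comm_monoid_add"
    by (simp add: UNIV_Plus_UNIV[symmetric] sum.Plus del: UNIV_Plus_UNIV) (simp add: UNIV_unit)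
  have eq1: "(\<Sum>k\<in>UNIV. w k *\<^sub>R fst (f k)) = 0"
    using arg_cong[OF eq, of fst] by (simp add: fst_sum)
  have eq2: "(\<Sum>k\<in>UNIV. w k *\<^sub>R fst (snd (f k))) = 0"
    using arg_cong[OF eq, of "\<lambda>p. fst (snd p)"] by (simp add: fst_sum snd_sum)
  have eq3: "(\<Sum>k\<in>UNIV. w k *\<^sub>R snd (snd (f k))) = 1"
    using arg_cong[OF eq, of "\<lambda>p. snd (snd p)"] by (simp add: snd_sum)
  show thesis
  proof
    show "?\<delta> \<in> unit_simplex"
      using w eq3 by (simp add: split f_def unit_simplex_def nonneg_orthant_def)
    show "?\<eta> \<in> nonneg_orthant" using w by (simp add: nonneg_orthant_def)
    show "(\<Sum>j\<in>UNIV. ?\<delta> $ j *\<^sub>R a $ j) + (\<Sum>i\<in>UNIV. ?\<eta> $ i *\<^sub>R c $ i) = 0"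
      using eq1 by (simp add: split f_def)
    \<comment> \<open>By \<open>eq2\<close> the right-hand side equals the weight of the slack
      generator.\<close>
    show "0 \<le> (\<Sum>j\<in>UNIV. ?\<delta> $ j * \<alpha> $ j) + (\<Sum>i\<in>UNIV. ?\<eta> $ i * \<gamma> $ i)"
      using eq2 w[of "Inr (Inr ())"] by (simp add: split f_def)
  qed
qed

text \<open>Pairing the dual equation with \<open>x\<close> and adding the dual inequality bounds
  \<open>\<mu> * ?B\<close> by the weighted sum of numerators plus that of constraints. The first is
  at most \<open>?t * ?B\<close>, since the weights \<open>\<delta>\<close> sum to 1, and the second
  is nonpositive.\<close>

lemma weak_duality:
  fixes a :: "(real ^ 'n) ^ 'r" and c :: "(real ^ 'n) ^ 'm"
  assumes x: "x \<in> primal_feasible c \<gamma>" and pos: "b \<bullet> x + \<beta> > 0"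
    and dual: "(\<delta>, \<eta>, \<mu>) \<in> dual_feasible a \<alpha> b \<beta> c \<gamma>"
  shows "\<mu> \<le> primal_objective a \<alpha> b \<beta> x"
proof -
  let ?t = "primal_objective a \<alpha> b \<beta> x" and ?B = "b \<bullet> x + \<beta>"
  from dual have eq: "(\<Sum>j\<in>UNIV. \<delta> $ j *\<^sub>R a $ j) + (\<Sum>i\<in>UNIV. \<eta> $ i *\<^sub>R c $ i) - \<mu> *\<^sub>R b = 0"
    and ge: "(\<Sum>j\<in>UNIV. \<delta> $ j * \<alpha> $ j) + (\<Sum>i\<in>UNIV. \<eta> $ i * \<gamma> $ i) - \<mu> * \<beta> \<ge> 0"
    and \<delta>: "\<And>j. 0 \<le> \<delta> $ j" "(\<Sum>j\<in>UNIV. \<delta> $ j) = 1" and \<eta>: "\<And>i. 0 \<le> \<eta> $ i"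
    by (auto simp: dual_feasible_def unit_simplex_def nonneg_orthant_def)
  have "a $ j \<bullet> x + \<alpha> $ j \<le> ?t * ?B" for j
  proof -
    have "(a $ j \<bullet> x + \<alpha> $ j) / ?B \<le> ?t"
      unfolding primal_objective_def by (rule Max_ge) auto
    with pos show ?thesis by (simp add: pos_divide_le_eq)
  qed
  then have "(\<Sum>j\<in>UNIV. \<delta> $ j * (a $ j \<bullet> x + \<alpha> $ j)) \<le> (\<Sum>j\<in>UNIV. \<delta> $ j * (?t * ?B))"
    by (intro sum_mono mult_left_mono \<delta>)
  also have "\<dots> = ?t * ?B" by (simp add: sum_distrib_right[symmetric] \<delta>)
  finally have 1: "(\<Sum>j\<in>UNIV. \<delta> $ j * (a $ j \<bullet> x + \<alpha> $ j)) \<le> ?t * ?B" .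
  have 2: "(\<Sum>i\<in>UNIV. \<eta> $ i * (c $ i \<bullet> x + \<gamma> $ i)) \<le> 0"
    using x \<eta> by (intro sum_nonpos) (simp add: primal_feasible_def mult_nonneg_nonpos)
  have 3: "(\<Sum>j\<in>UNIV. \<delta> $ j * (a $ j \<bullet> x)) + (\<Sum>i\<in>UNIV. \<eta> $ i * (c $ i \<bullet> x)) = \<mu> * (b \<bullet> x)"
    using arg_cong[OF eq, of "\<lambda>p. p \<bullet> x"]
    by (simp add: inner_add_left inner_diff_left inner_sum_left)
  have "\<mu> * ?B \<le> ?t * ?B"
    using 1 2 3 ge by (simp add: distrib_left sum.distrib)
  with pos show ?thesis by simp
qed

theorem corollary4p7:
  fixes a :: "(real ^ 'n) ^ 'r" and \<alpha> :: "real ^ 'r"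
    and b :: "real ^ 'n" and \<beta> :: real
    and c :: "(real ^ 'n) ^ 'm" and \<gamma> :: "real ^ 'm"
  assumes "primal_feasible c \<gamma> \<noteq> {}"
    and "\<And>x. x \<in> primal_feasible c \<gamma> \<Longrightarrow> b \<bullet> x + \<beta> > 0"
  shows "primal_value a \<alpha> b \<beta> c \<gamma> = dual_value a \<alpha> b \<beta> c \<gamma> \<and>
    (\<bar>dual_value a \<alpha> b \<beta> c \<gamma>\<bar> \<noteq> \<infinity> \<longrightarrow>
      (\<exists>(\<delta>, \<eta>, \<mu>)\<in>dual_feasible a \<alpha> b \<beta> c \<gamma>. ereal \<mu> = dual_value a \<alpha> b \<beta> c \<gamma>))"
proof -
  let ?P = "primal_value a \<alpha> b \<beta> c \<gamma>" and ?D = "dual_value a \<alpha> b \<beta> c \<gamma>"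
  obtain x0 where x0: "x0 \<in> primal_feasible c \<gamma>" using assms(1) by blast
  have weak: "?D \<le> ?P"
    unfolding dual_value_def primal_value_def
    using weak_duality[OF _ assms(2)] by (intro SUP_least INF_greatest) auto
  \<comment> \<open>The feasible point excludes the value plus infinity.\<close>
  have "?P \<le> ereal (primal_objective a \<alpha> b \<beta> x0)"
    unfolding primal_value_def using x0 by (rule INF_lower)
  then consider "?P = -\<infinity>" | v where "?P = ereal v" by (cases ?P) auto
  then show ?thesis
  proof cases
    case 1
    \<comment> \<open>Weak duality forces both values to be minus infinity, so attainment is
      vacuous.\<close>
    with weak show ?thesis by simp
  next
    case (2 v)
    let ?a = "\<chi> j. a $ j - v *\<^sub>R b" and ?\<alpha> = "\<chi> j. \<alpha> $ j - v * \<beta>"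
    have "\<exists>j. 0 \<le> ?a $ j \<bullet> x + ?\<alpha> $ j" if x: "x \<in> primal_feasible c \<gamma>" for x
    proof -
      have "ereal v \<le> ereal (primal_objective a \<alpha> b \<beta> x)"
        unfolding 2[symmetric] primal_value_def using x by (rule INF_lower)
      then obtain j where "v \<le> (a $ j \<bullet> x + \<alpha> $ j) / (b \<bullet> x + \<beta>)"
        unfolding primal_objective_def by (auto simp: Max_ge_iff)
      with assms(2)[OF x] have "v * (b \<bullet> x + \<beta>) \<le> a $ j \<bullet> x + \<alpha> $ j"
        by (simp add: pos_le_divide_eq)
      then show ?thesis by (auto intro!: exI[of _ j] simp: algebra_simps inner_diff_left)
    qed
    from affine_alternative[OF x0 this] obtain \<delta> \<eta> where
      mult: "\<delta> \<in> unit_simplex" "\<eta> \<in> nonneg_orthant"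
      "(\<Sum>j\<in>UNIV. \<delta> $ j *\<^sub>R ?a $ j) + (\<Sum>i\<in>UNIV. \<eta> $ i *\<^sub>R c $ i) = 0"
      "0 \<le> (\<Sum>j\<in>UNIV. \<delta> $ j * ?\<alpha> $ j) + (\<Sum>i\<in>UNIV. \<eta> $ i * \<gamma> $ i)"
      by blast
    \<comment> \<open>Because the weights sum to 1, the shifts by \<open>v *\<^sub>R b\<close> and
      \<open>v * \<beta>\<close> come out exactly once, which gives the dual constraints with
      \<open>\<mu> = v\<close>.\<close>
    have sum1: "(\<Sum>j\<in>UNIV. \<delta> $ j) = 1" using mult(1) by (simp add: unit_simplex_def)
    have a_sum: "(\<Sum>j\<in>UNIV. \<delta> $ j *\<^sub>R ?a $ j) = (\<Sum>j\<in>UNIV. \<delta> $ j *\<^sub>R a $ j) - (\<Sum>j\<in>UNIV. \<delta> $ j) *\<^sub>R (v *\<^sub>R b)"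
      by (simp add: scaleR_diff_right sum_subtractf sum_distrib_right flip: scaleR_sum_left)
    have \<alpha>_sum: "(\<Sum>j\<in>UNIV. \<delta> $ j * ?\<alpha> $ j) = (\<Sum>j\<in>UNIV. \<delta> $ j * \<alpha> $ j) - (\<Sum>j\<in>UNIV. \<delta> $ j) * (v * \<beta>)"
      by (simp add: right_diff_distrib sum_subtractf sum_distrib_right)
    have dual: "(\<delta>, \<eta>, v) \<in> dual_feasible a \<alpha> b \<beta> c \<gamma>"
      using mult(1,2) mult(3,4)[unfolded a_sum \<alpha>_sum sum1]
      by (simp add: dual_feasible_def algebra_simps)
    then have "ereal v \<le> ?D"
      unfolding dual_value_def by (intro SUP_upper2[OF dual]) simp
    with weak 2 have "?D = ereal v" by simp
    with 2 dual show ?thesis by auto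
  qed
qed

end
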